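(* Let $T$ be an $n$-vertex rooted tree. Then $$\rho_L(T)\ge\sqrt{\frac1n\sum_{j=1}^n L_j(T)^2}.$$
   Context: A rooted tree is a finite tree with a distinguished vertex (the root). The level $l(v)$ of a vertex $v$ is its distance from the root. For a rooted tree $T$ with vertices $v_1,\dots,v_n$, the level matrix $L(T)=(l_{ij})$ is the $n\times n$ real symmetric matrix with $l_{ij}=|l(v_i)-l(v_j)|$. The level spectral radius $\rho_L(T)$ is the largest absolute value of an eigenvalue of $L(T)$. Set $L_i(T)=\sum_{j=1}^n l_{ij}$ (the $i$-th row sum). *)

theory Defs
  imports
    "Graph_Theory.Digraph_Component"
    "Graph_Theory.Shortest_Path"
    "Jordan_Normal_Form.Spectral_Radius"
begin

text \<open>
  A tree is a simple undirected graph, that is, a finite symmetric digraph without loops or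
  parallel arcs. The library predicate \<open>tree\<close> does not fit this representation: in a symmetric
  digraph every edge \<open>{a, b}\<close> already yields the directed cycle \<open>a, b, a\<close> of length 2. The cycles
  of length at least 3 are exactly those of the undirected graph.
\<close>

locale rooted_tree = graph T for T :: "('a, 'b) pre_digraph" +
  fixes r :: 'a
  assumes connected: "connected T"
    and acyclic: "\<nexists>p. cycle p \<and> length p \<ge> 3"
    and root_in_verts: "r \<in> verts T"

text \<open>
  The distance between two vertices is the shortest-path cost for unit arc weights. The cost is
  finite between vertices of a connected graph; see \<open>level_eq_Least\<close> below.
\<close>

definition level :: "('a, 'b) pre_digraph \<Rightarrow> 'a \<Rightarrow> 'a \<Rightarrow> real" where
  "level T r x = real_of_ereal (wf_digraph.\<mu> T (\<lambda>_. 1) r x)"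

text \<open>
  The matrix and everything below depend on an enumeration \<open>v 0, \<dots>, v (n - 1)\<close> of the vertices;
  indices start at 0.
\<close>

definition level_matrix ::
    "('a, 'b) pre_digraph \<Rightarrow> 'a \<Rightarrow> (nat \<Rightarrow> 'a) \<Rightarrow> nat \<Rightarrow> real mat" where
  "level_matrix T r v n = mat n n (\<lambda>(i, j). \<bar>level T r (v i) - level T r (v j)\<bar>)"

definition level_spectral_radius ::
    "('a, 'b) pre_digraph \<Rightarrow> 'a \<Rightarrow> (nat \<Rightarrow> 'a) \<Rightarrow> nat \<Rightarrow> real" where
  "level_spectral_radius T r v n =
     spectral_radius (map_mat complex_of_real (level_matrix T r v n))"

definition level_row_sum ::
    "('a, 'b) pre_digraph \<Rightarrow> 'a \<Rightarrow> (nat \<Rightarrow> 'a) \<Rightarrow> nat \<Rightarrow> nat \<Rightarrow> real" where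
  "level_row_sum T r v n i = (\<Sum>j<n. level_matrix T r v n $$ (i, j))"

lemma (in rooted_tree) level_eq_Least:
  assumes "x \<in> verts T"
  shows "level T r x = real (LEAST k. \<exists>p. awalk r p x \<and> length p = k)"
proof -
  let ?P = "\<lambda>k. \<exists>p. awalk r p x \<and> length p = k"
  have "strongly_connected T"
    using connected symmetric_connected_imp_strongly_connected sym_arcs by blast
  then obtain q where q: "awalk r q x"
    using assms root_in_verts unfolding strongly_connected_def reachable_awalk by blast
  have cost: "awalk_cost (\<lambda>_. 1) p = real (length p)" for p :: "'b list"
    unfolding awalk_cost_def by (induction p) auto
  have ex: "?P (length q)" using q by blast
  obtain p where p: "awalk r p x" "length p = (LEAST k. ?P k)"
    using LeastI[of ?P, OF ex] by blast
  have "\<mu> (\<lambda>_. 1) r x = ereal (real (LEAST k. ?P k))"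
    unfolding \<mu>_def
  proof (rule antisym)
    show "(INF p\<in>{p. awalk r p x}. ereal (awalk_cost (\<lambda>_. 1) p)) \<le> ereal (real (LEAST k. ?P k))"
      using p by (intro INF_lower2[of p]) (auto simp: cost)
    show "ereal (real (LEAST k. ?P k)) \<le> (INF p\<in>{p. awalk r p x}. ereal (awalk_cost (\<lambda>_. 1) p))"
      by (rule INF_greatest) (auto simp: cost intro!: Least_le)
  qed
  then show ?thesis by (simp add: level_def)
qed

end

theory Submission
  imports Defs "HOL-Analysis.Convex"
begin

text \<open>
  The level matrix \<open>A\<close> is real symmetric. Its row sums are the entries of \<open>A e\<close>, where \<open>e\<close> is the
  all-ones vector, so the claim says \<open>\<bar>A e\<bar> \<le> \<rho> \<bar>e\<bar>\<close> for the Euclidean norm and the spectral radius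
  \<open>\<rho>\<close> of \<open>A\<close>. This inequality holds for every real symmetric matrix and every real
  vector \<open>x\<close> in place of \<open>e\<close> (\<open>symmetric_mat_norm_le_spectral_radius\<close>).

  Instead of diagonalising \<open>A\<close>, the proof compares two estimates of the growth of
  \<open>s k = \<bar>A\<^sup>k x\<bar>\<^sup>2\<close>. By symmetry \<open>s (k + 1)\<close> is the inner product of \<open>A\<^sup>k x\<close> and \<open>A\<^sup>k\<^sup>+\<^sup>2 x\<close>, so the
  Cauchy-Schwarz inequality makes \<open>s\<close> log-convex, and a log-convex sequence grows at least as fast as
  its first step suggests: \<open>s k \<ge> q\<^sup>k s 0\<close> for \<open>q = s 1 / s 0\<close>. On the other hand, if \<open>c > \<rho>\<close> then
  the spectral radius of \<open>A / c\<close> is less than 1, so the powers of \<open>A / c\<close> are bounded (this is where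
  the Jordan normal form enters) and \<open>s k\<close> is at most a constant times \<open>c\<^sup>2\<^sup>k\<close>. Hence
  \<open>q \<le> c\<^sup>2\<close> for every \<open>c > \<rho>\<close>, that is, \<open>q \<le> \<rho>\<^sup>2\<close>.
\<close>

lemma spectral_radius_nonneg:
  assumes "A \<in> carrier_mat n n" and "n > 0"
  shows "spectral_radius A \<ge> 0"
  using spectral_radius_mem_max(1)[OF assms] by auto

lemma spectral_radius_smult_less_1:
  assumes A: "A \<in> carrier_mat n n" and n: "n > 0"
    and c: "spectral_radius A < c"
  shows "spectral_radius (complex_of_real (1 / c) \<cdot>\<^sub>m A) < 1"
proof -
  let ?k = "complex_of_real (1 / c)"
  have c0: "c > 0"
    using spectral_radius_nonneg[OF A n] c by simp
  have B: "?k \<cdot>\<^sub>m A \<in> carrier_mat n n"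
    using A by simp
  obtain \<mu> where \<mu>: "\<mu> \<in> spectrum (?k \<cdot>\<^sub>m A)" "spectral_radius (?k \<cdot>\<^sub>m A) = norm \<mu>"
    using spectral_radius_mem_max(1)[OF B n] by auto
  have "char_poly (?k \<cdot>\<^sub>m A) \<noteq> 0" "char_poly A \<noteq> 0"
    using degree_monic_char_poly[OF B] degree_monic_char_poly[OF A] by auto
  moreover have "order \<mu> (char_poly (?k \<cdot>\<^sub>m A)) = order (\<mu> / ?k) (char_poly A)"
    using c0 by (intro order_char_poly_smult[OF A]) simp
  ultimately have "\<mu> / ?k \<in> spectrum A"
    using \<mu>(1) unfolding spectrum_root_char_poly[OF A] spectrum_root_char_poly[OF B]
    by (simp only: mem_Collect_eq order_root simp_thms)
  then have "norm (\<mu> / ?k) \<le> spectral_radius A"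
    by (intro spectral_radius_mem_max(2)[OF A n] imageI)
  moreover have "norm (\<mu> / ?k) = norm \<mu> * c"
    using c0 by (simp add: norm_divide norm_mult)
  ultimately have "norm \<mu> * c < 1 * c"
    using c by linarith
  then have "norm \<mu> < 1"
    using c0 by (simp only: mult_less_cancel_right_pos)
  then show ?thesis
    using \<mu>(2) by simp
qed

lemma pow_smult_mat:
  fixes A :: "'a :: comm_semiring_1 mat"
  assumes A: "A \<in> carrier_mat n n"
  shows "(a \<cdot>\<^sub>m A) ^\<^sub>m k = a ^ k \<cdot>\<^sub>m (A ^\<^sub>m k)"
proof (induction k)
  case 0
  show ?case using A by (intro eq_matI) auto
next
  case (Suc k)
  have "A ^\<^sub>m k \<in> carrier_mat n n" using A by simp
  then show ?case
    using A Suc by (intro eq_matI) (auto simp: mult_smult_distrib mult_smult_assoc_mat mult_ac)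
qed

text \<open>
  A bound \<open>c > \<rho>\<close> avoids the polynomial factor that nontrivial Jordan blocks can cause at \<open>c = \<rho>\<close>.
  Passing to \<open>A / c\<close> turns it into the boundedness of powers for spectral radius below 1.
\<close>

lemma mat_pow_entry_bound:
  assumes A: "A \<in> carrier_mat n n" and n: "n > 0"
    and c: "spectral_radius A < c"
  obtains C where "C \<ge> 0" and "\<And>k i j. i < n \<Longrightarrow> j < n \<Longrightarrow> norm ((A ^\<^sub>m k) $$ (i, j)) \<le> C * c ^ k"
proof -
  let ?a = "complex_of_real (1 / c)"
  have c0: "c > 0"
    using spectral_radius_nonneg[OF A n] c by simp
  have B: "?a \<cdot>\<^sub>m A \<in> carrier_mat n n"
    using A by simp
  obtain C where C: "\<And>k. norm_bound ((?a \<cdot>\<^sub>m A) ^\<^sub>m k) C"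
    using spectral_radius_jnf_norm_bound_less_1_upper_triangular
      [OF B spectral_radius_smult_less_1[OF A n c]] by blast
  have bound: "norm ((A ^\<^sub>m k) $$ (i, j)) \<le> C * c ^ k" if "i < n" "j < n" for k i j
  proof -
    have Ak: "A ^\<^sub>m k \<in> carrier_mat n n" using A by simp
    have "norm ((?a ^ k \<cdot>\<^sub>m (A ^\<^sub>m k)) $$ (i, j)) \<le> C"
      using C[of k] that Ak A unfolding norm_bound_def pow_smult_mat[OF A] by simp
    then show ?thesis
      using that Ak A c0 by (simp add: norm_mult norm_power norm_divide field_simps)
  qed
  have "C \<ge> 0"
    using order.trans[OF norm_ge_zero bound[OF n n, of 0]] by simp
  then show ?thesis using bound that by blast
qed

lemma scalar_prod_self_nonneg: "(x :: real vec) \<bullet> x \<ge> 0"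
  by (simp add: scalar_prod_def sum_nonneg)

lemma scalar_prod_Cauchy_Schwarz:
  fixes x y :: "real vec"
  assumes "dim_vec x = dim_vec y"
  shows "(x \<bullet> y)\<^sup>2 \<le> (x \<bullet> x) * (y \<bullet> y)"
  using Cauchy_Schwarz_ineq_sum[of "vec_index x" "vec_index y" "{0..<dim_vec y}"] assms
  by (simp add: scalar_prod_def power2_eq_square)

text \<open>
  Log-convexity says that the ratios \<open>s (k + 1) / s k\<close> increase. The product form used here also
  makes sense where \<open>s\<close> vanishes; \<open>s 1 > 0\<close> then excludes zeros altogether.
\<close>

lemma log_convex_geometric_growth:
  fixes s :: "nat \<Rightarrow> real"
  assumes nonneg: "\<And>k. s k \<ge> 0"
    and log_convex: "\<And>k. (s (Suc k))\<^sup>2 \<le> s k * s (Suc (Suc k))"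
    and pos: "s 1 > 0"
  shows "s 0 > 0" and "s 0 * (s 1 / s 0) ^ k \<le> s k"
proof -
  show s0: "s 0 > 0"
  proof (rule ccontr)
    assume "\<not> s 0 > 0"
    then have "s 0 = 0" using nonneg[of 0] by simp
    then show False using log_convex[of 0] pos by simp
  qed
  define q where "q = s 1 / s 0"
  have q: "q > 0" unfolding q_def using s0 pos by simp
  have ratio: "s k > 0 \<and> q * s k \<le> s (Suc k)" for k
  proof (induction k)
    case 0
    then show ?case using s0 by (simp add: q_def)
  next
    case (Suc k)
    then have pos': "s (Suc k) > 0"
      using q by (smt (verit) mult_pos_pos)
    have "s k * (q * s (Suc k)) \<le> s (Suc k) * s (Suc k)"
      using Suc pos' mult_right_mono[of "q * s k" "s (Suc k)" "s (Suc k)"]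
      by (simp add: mult_ac)
    also have "\<dots> \<le> s k * s (Suc (Suc k))"
      using log_convex[of k] by (simp add: power2_eq_square)
    finally show ?case using Suc pos' by simp
  qed
  have "s 0 * q ^ k \<le> s k"
  proof (induction k)
    case (Suc k)
    have "s 0 * q ^ Suc k \<le> q * s k"
      using Suc q by (simp add: mult_ac)
    then show ?case using ratio[of k] by simp
  qed simp
  then show "s 0 * (s 1 / s 0) ^ k \<le> s k" by (simp add: q_def)
qed

text \<open>
  Otherwise the lower bound \<open>s 0 * q ^ k\<close> with \<open>q = s 1 / s 0 > b\<close> would outgrow \<open>D * b ^ k\<close>.
\<close>

lemma log_convex_first_step_le:
  fixes s :: "nat \<Rightarrow> real"
  assumes nonneg: "\<And>k. s k \<ge> 0"
    and log_convex: "\<And>k. (s (Suc k))\<^sup>2 \<le> s k * s (Suc (Suc k))"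
    and upper: "\<And>k. s k \<le> D * b ^ k"
    and b: "b > 0"
  shows "s 1 \<le> b * s 0"
proof (rule ccontr)
  assume less: "\<not> s 1 \<le> b * s 0"
  have s1: "s 1 > 0"
    using less b nonneg[of 0] by (smt (verit) mult_nonneg_nonneg)
  note growth = log_convex_geometric_growth[OF nonneg log_convex s1]
  define t where "t = s 1 / s 0 / b"
  have "t > 1"
    using less growth(1) b by (simp add: t_def field_simps)
  then obtain k where k: "D / s 0 < t ^ k"
    using real_arch_pow by blast
  have "s 0 * t ^ k * b ^ k = s 0 * (s 1 / s 0) ^ k"
    using b by (simp add: t_def power_divide power_mult_distrib)
  also have "\<dots> \<le> D * b ^ k"
    using growth(2) upper by (rule order.trans)
  finally have "s 0 * t ^ k \<le> D"
    using b by simp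
  then show False
    using k growth(1) by (simp add: field_simps)
qed

lemma pow_mat_Suc_mult_vec:
  assumes A: "A \<in> carrier_mat n n" and x: "x \<in> carrier_vec n"
  shows "(A ^\<^sub>m Suc k) *\<^sub>v x = A *\<^sub>v ((A ^\<^sub>m k) *\<^sub>v x)"
  using x
proof (induction k arbitrary: x)
  case 0
  then show ?case using A by simp
next
  case (Suc k)
  have Ak: "A ^\<^sub>m m \<in> carrier_mat n n" for m using A by simp
  have Ax: "A *\<^sub>v x \<in> carrier_vec n" using A Suc.prems by simp
  have shift: "(A ^\<^sub>m Suc m) *\<^sub>v x = (A ^\<^sub>m m) *\<^sub>v (A *\<^sub>v x)" for m
    using assoc_mult_mat_vec[OF Ak A Suc.prems] by simp
  show ?case
    unfolding shift using Suc.IH[OF Ax] by simp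
qed

lemma pow_mat_mult_vec_norm_bound:
  fixes A :: "real mat"
  assumes A: "A \<in> carrier_mat n n" and n: "n > 0" and x: "x \<in> carrier_vec n"
    and c: "spectral_radius (map_mat complex_of_real A) < c"
  obtains D where "\<And>k. ((A ^\<^sub>m k) *\<^sub>v x) \<bullet> ((A ^\<^sub>m k) *\<^sub>v x) \<le> D * (c\<^sup>2) ^ k"
proof -
  let ?M = "map_mat complex_of_real A"
  have M: "?M \<in> carrier_mat n n" using A by simp
  obtain C where C0: "C \<ge> 0"
    and C: "\<And>k i j. i < n \<Longrightarrow> j < n \<Longrightarrow> norm ((?M ^\<^sub>m k) $$ (i, j)) \<le> C * c ^ k"
    using mat_pow_entry_bound[OF M n c] by blast
  define X where "X = (\<Sum>j<n. \<bar>x $ j\<bar>)"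
  have "((A ^\<^sub>m k) *\<^sub>v x) \<bullet> ((A ^\<^sub>m k) *\<^sub>v x) \<le> real n * (C * X)\<^sup>2 * (c\<^sup>2) ^ k" for k
  proof -
    let ?y = "(A ^\<^sub>m k) *\<^sub>v x"
    have Ak: "A ^\<^sub>m k \<in> carrier_mat n n" using A by simp
    have dims: "dim_row (A ^\<^sub>m k) = n" "dim_col (A ^\<^sub>m k) = n" "dim_vec x = n"
      using Ak x by auto
    have entry: "\<bar>(A ^\<^sub>m k) $$ (i, j)\<bar> \<le> C * c ^ k" if "i < n" "j < n" for i j
      using C[OF that, of k] that dims by (simp add: of_real_hom.mat_hom_pow[OF A, symmetric])
    have y: "\<bar>?y $ i\<bar> \<le> C * c ^ k * X" if i: "i < n" for i
    proof -
      have "?y $ i = (\<Sum>j<n. (A ^\<^sub>m k) $$ (i, j) * x $ j)"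
        using i dims by (simp add: scalar_prod_def atLeast0LessThan)
      also have "\<bar>\<dots>\<bar> \<le> (\<Sum>j<n. \<bar>(A ^\<^sub>m k) $$ (i, j) * x $ j\<bar>)"
        by (rule sum_abs)
      also have "\<dots> \<le> (\<Sum>j<n. C * c ^ k * \<bar>x $ j\<bar>)"
        using entry[OF i] by (intro sum_mono) (simp add: abs_mult mult_right_mono)
      finally show ?thesis by (simp add: X_def sum_distrib_left)
    qed
    have "?y \<bullet> ?y = (\<Sum>i<n. \<bar>?y $ i\<bar>\<^sup>2)"
      using dims by (simp add: scalar_prod_def atLeast0LessThan power2_eq_square)
    also have "\<dots> \<le> (\<Sum>i<n. (C * c ^ k * X)\<^sup>2)"
      using y by (intro sum_mono power_mono) auto
    also have "\<dots> = real n * (C * X)\<^sup>2 * (c\<^sup>2) ^ k"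
      by (simp add: power_mult_distrib power_mult[symmetric] mult_ac)
    finally show ?thesis .
  qed
  then show ?thesis by (rule that)
qed

text \<open>
  Here the two growth estimates for \<open>\<bar>A\<^sup>k x\<bar>\<^sup>2\<close> meet. Symmetry enters only through log-convexity: for a
  nilpotent \<open>A \<noteq> 0\<close> the upper estimate still holds, but the conclusion fails for some \<open>x\<close>.
\<close>

lemma symmetric_mat_norm_le_spectral_radius:
  fixes A :: "real mat"
  assumes A: "A \<in> carrier_mat n n" and n: "n > 0"
    and sym: "A\<^sup>T = A" and x: "x \<in> carrier_vec n"
  shows "(A *\<^sub>v x) \<bullet> (A *\<^sub>v x) \<le> (spectral_radius (map_mat complex_of_real A))\<^sup>2 * (x \<bullet> x)"
proof -
  let ?\<rho> = "spectral_radius (map_mat complex_of_real A)"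
  have M: "map_mat complex_of_real A \<in> carrier_mat n n" using A by simp
  have \<rho>0: "?\<rho> \<ge> 0" using spectral_radius_nonneg[OF M n] .
  define y where "y k = (A ^\<^sub>m k) *\<^sub>v x" for k
  have y: "y k \<in> carrier_vec n" for k
    unfolding y_def using A x by (intro mult_mat_vec_carrier[of _ n n]) simp_all
  have y_Suc: "y (Suc k) = A *\<^sub>v y k" for k
    unfolding y_def by (rule pow_mat_Suc_mult_vec[OF A x])
  have y0: "y 0 = x" using A x by (simp add: y_def)
  define s where "s k = y k \<bullet> y k" for k
  have nonneg: "s k \<ge> 0" for k
    by (simp add: s_def scalar_prod_self_nonneg)
  have log_convex: "(s (Suc k))\<^sup>2 \<le> s k * s (Suc (Suc k))" for k
  proof -
    have "s (Suc k) = (A\<^sup>T *\<^sub>v y k) \<bullet> y (Suc k)"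
      by (simp add: s_def y_Suc sym)
    also have "\<dots> = y k \<bullet> y (Suc (Suc k))"
      using transpose_vec_mult_scalar[OF A y[of "Suc k"] y[of k]] by (simp only: y_Suc[of "Suc k"])
    finally show ?thesis
      using scalar_prod_Cauchy_Schwarz[of "y k" "y (Suc (Suc k))"] y[THEN carrier_vecD]
      by (simp add: s_def)
  qed
  have step: "s 1 \<le> c\<^sup>2 * s 0" if c: "?\<rho> < c" for c
  proof -
    obtain D where "\<And>k. s k \<le> D * (c\<^sup>2) ^ k"
      using pow_mat_mult_vec_norm_bound[OF A n x c] unfolding s_def y_def by blast
    moreover have "c\<^sup>2 > 0" using c \<rho>0 by simp
    ultimately show ?thesis
      using log_convex_first_step_le[of s D "c\<^sup>2"] nonneg log_convex by blast
  qed
  \<comment> \<open>The strict bound \<open>c > \<rho>\<close> is removed by letting \<open>c\<close> decrease to \<open>\<rho>\<close>.\<close>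
  have "((\<lambda>c. c\<^sup>2 * s 0) \<longlongrightarrow> ?\<rho>\<^sup>2 * s 0) (at_right ?\<rho>)"
    by (intro tendsto_intros)
  moreover have "eventually (\<lambda>c. s 1 \<le> c\<^sup>2 * s 0) (at_right ?\<rho>)"
    using eventually_at_right_less by (rule eventually_mono) (rule step)
  ultimately have "s 1 \<le> ?\<rho>\<^sup>2 * s 0"
    by (rule tendsto_lowerbound) simp
  then show ?thesis by (simp add: s_def y0 y_Suc)
qed

theorem theorem3:
  fixes T :: "('a, 'b) pre_digraph" and r :: 'a and v :: "nat \<Rightarrow> 'a" and n :: nat
  assumes "rooted_tree T r"
    and "bij_betw v {..<n} (verts T)"
  shows "level_spectral_radius T r v n \<ge>
    sqrt (1 / real n * (\<Sum>j<n. (level_row_sum T r v n j)\<^sup>2))"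
proof -
  have "verts T \<noteq> {}"
    using rooted_tree.root_in_verts[OF assms(1)] by auto
  then have n: "n > 0"
    using assms(2) by (cases n) (auto simp: bij_betw_def)
  let ?A = "level_matrix T r v n" and ?e = "vec n (\<lambda>_. 1 :: real)"
  let ?\<rho> = "level_spectral_radius T r v n"
  have A: "?A \<in> carrier_mat n n"
    by (simp add: level_matrix_def)
  have M: "map_mat complex_of_real ?A \<in> carrier_mat n n" using A by simp
  have sym: "?A\<^sup>T = ?A"
    by (intro eq_matI) (auto simp: level_matrix_def)
  have "(?A *\<^sub>v ?e) $ j = level_row_sum T r v n j" if "j < n" for j
    using that A by (simp add: level_row_sum_def scalar_prod_def atLeast0LessThan)
  then have "(?A *\<^sub>v ?e) \<bullet> (?A *\<^sub>v ?e) = (\<Sum>j<n. (level_row_sum T r v n j)\<^sup>2)"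
    using A by (simp add: scalar_prod_def atLeast0LessThan power2_eq_square)
  moreover have "?e \<bullet> ?e = real n"
    by (simp add: scalar_prod_def)
  ultimately have "(\<Sum>j<n. (level_row_sum T r v n j)\<^sup>2) \<le> ?\<rho>\<^sup>2 * real n"
    using symmetric_mat_norm_le_spectral_radius[OF A n sym, of ?e]
    by (simp add: level_spectral_radius_def)
  then have "1 / real n * (\<Sum>j<n. (level_row_sum T r v n j)\<^sup>2) \<le> ?\<rho>\<^sup>2"
    using n by (simp add: field_simps)
  moreover have "?\<rho> \<ge> 0"
    unfolding level_spectral_radius_def using spectral_radius_nonneg[OF M n] .
  ultimately show ?thesis
    by (intro real_le_lsqrt)
qed

end
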